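(* Let $X\subset\Sigma^{\mathbb{Z}}$ be a one-dimensional subshift over a finite alphabet $\Sigma$. Then the group $\mathrm{RFA}(X)$ is generated by the orbitwise shifts on $X$ together with the controlled position swaps on $X$.
   Context: A one-dimensional subshift $X\subset\Sigma^{\mathbb{Z}}$ is a closed subset invariant under the shift $(\sigma^{m}(x))_i=x_{i-m}$. $\mathrm{RFA}(X)$ (one-state reversible finite-state automata on $X$, moving head model) is the group, under composition, of all bijections $T:X\times\mathbb{Z}\to X\times\mathbb{Z}$ (tape, head position) for which there is a continuous function $s:X\to\mathbb{Z}$ with $T(x,i)=(x,\,i+s(\sigma^{-i}(x)))$ for all $(x,i)$, and whose inverse is also of this form. $T\in\mathrm{RFA}(X)$ is an orbitwise shift if for every $x\in X$ there is $m\in\mathbb{Z}$ such that $T(x,i)=(x,i-m)$ for all $i\in\mathbb{Z}$. Controlled position swaps: for words $u,v\in\Sigma^*$ and $a\in\Sigma$, let $C=\{x\in X: x_{-|u|}\cdots x_{-1}=u,\ x_0=a,\ x_1\cdots x_{|v|}=v\}$. The controlled position swap $T_{u,a,v}$ is the map exchanging the head positions $0$ and $1$ on configurations in $C$, extended by shift-commutation and acting trivially otherwise: $T_{u,a,v}(x,i)=(x,i+1)$ if $\sigma^{-i}(x)\in C$; $T_{u,a,v}(x,i)=(x,i-1)$ if $\sigma^{-i+1}(x)\in C$; and $T_{u,a,v}(x,i)=(x,i)$ otherwise. It is considered whenever it is well defined (i.e. $C\cap\sigma(C)=\varnothing$; for instance whenever $uav$ is not a power of the letter $a$), in which case it belongs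 to $\mathrm{RFA}(X)$. *)

theory Defs
  imports
    "HOL-Analysis.Function_Topology"
    "HOL-Algebra.Bij"
    "HOL-Algebra.Generated_Groups"
begin

definition full_shift :: "'a set \<Rightarrow> (int \<Rightarrow> 'a) topology" where
  "full_shift A = product_topology (\<lambda>_. discrete_topology A) UNIV"

definition shift :: "int \<Rightarrow> (int \<Rightarrow> 'a) \<Rightarrow> (int \<Rightarrow> 'a)" where
  "shift m x = (\<lambda>i. x (i - m))"

definition subshift :: "'a set \<Rightarrow> (int \<Rightarrow> 'a) set \<Rightarrow> bool" where
  "subshift A X \<longleftrightarrow> closedin (full_shift A) X \<and> (\<forall>m. \<forall>x\<in>X. shift m x \<in> X)"

type_synonym 'a head_conf = "(int \<Rightarrow> 'a) \<times> int"

definition moves_head ::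
    "'a set \<Rightarrow> (int \<Rightarrow> 'a) set \<Rightarrow> ('a head_conf \<Rightarrow> 'a head_conf) \<Rightarrow> bool" where
  "moves_head A X T \<longleftrightarrow>
     (\<exists>s :: (int \<Rightarrow> 'a) \<Rightarrow> int.
        continuous_map (subtopology (full_shift A) X) (discrete_topology UNIV) s \<and>
        (\<forall>x\<in>X. \<forall>i. T (x, i) = (x, i + s (shift (- i) x))))"

text \<open>Maps on \<open>X \<times> \<int>\<close> are represented as in \<^const>\<open>BijGroup\<close>, that is, extensionally:
  they take the value \<^const>\<open>undefined\<close> outside \<open>X \<times> \<int>\<close>.\<close>

definition RFA :: "'a set \<Rightarrow> (int \<Rightarrow> 'a) set \<Rightarrow> ('a head_conf \<Rightarrow> 'a head_conf) monoid" where
  "RFA A X = (BijGroup (X \<times> UNIV))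
     \<lparr>carrier := {T \<in> Bij (X \<times> UNIV).
        moves_head A X T \<and> moves_head A X (inv_into (X \<times> UNIV) T)}\<rparr>"

definition orbitwise_shifts ::
    "'a set \<Rightarrow> (int \<Rightarrow> 'a) set \<Rightarrow> ('a head_conf \<Rightarrow> 'a head_conf) set" where
  "orbitwise_shifts A X =
     {T \<in> carrier (RFA A X). \<forall>x\<in>X. \<exists>m. \<forall>i. T (x, i) = (x, i - m)}"

definition context_cylinder ::
    "(int \<Rightarrow> 'a) set \<Rightarrow> 'a list \<Rightarrow> 'a \<Rightarrow> 'a list \<Rightarrow> (int \<Rightarrow> 'a) set" where
  "context_cylinder X u a v =
     {x \<in> X. map x [- int (length u)..-1] = u \<and> x 0 = a \<and> map x [1..int (length v)] = v}"

definition position_swap ::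
    "(int \<Rightarrow> 'a) set \<Rightarrow> 'a list \<Rightarrow> 'a \<Rightarrow> 'a list \<Rightarrow> 'a head_conf \<Rightarrow> 'a head_conf" where
  "position_swap X u a v =
     (\<lambda>(x, i) \<in> X \<times> UNIV.
        if shift (- i) x \<in> context_cylinder X u a v then (x, i + 1)
        else if shift (- i + 1) x \<in> context_cylinder X u a v then (x, i - 1)
        else (x, i))"

text \<open>A swap is well defined iff the first two cases of \<^const>\<open>position_swap\<close> exclude
  each other, which is the disjointness condition below.\<close>

definition controlled_position_swaps ::
    "'a set \<Rightarrow> (int \<Rightarrow> 'a) set \<Rightarrow> ('a head_conf \<Rightarrow> 'a head_conf) set" where
  "controlled_position_swaps A X =
     {position_swap X u a v | u a v.
        u \<in> lists A \<and> a \<in> A \<and> v \<in> lists A \<and>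
        context_cylinder X u a v \<inter> shift 1 ` context_cylinder X u a v = {}}"

lemma shift_shift [simp]: "shift m (shift n x) = shift (m + n) x"
  by (simp add: shift_def algebra_simps)

lemma shift_0 [simp]: "shift 0 x = x"
  by (simp add: shift_def)

lemma continuous_map_shift: "continuous_map (full_shift A) (full_shift A) (shift m)"
  unfolding full_shift_def continuous_map_componentwise_UNIV shift_def
  by (auto intro: continuous_map_product_projection)

lemma continuous_map_shift_by:
  assumes X: "subshift A X"
    and s: "continuous_map (subtopology (full_shift A) X) (discrete_topology UNIV) s"
    and t: "continuous_map (subtopology (full_shift A) X) (discrete_topology UNIV) t"
  shows "continuous_map (subtopology (full_shift A) X) (discrete_topology UNIV)
           (\<lambda>x. s x + t (shift (- s x) x) :: int)"
proof -
  let ?Y = "subtopology (full_shift A) X"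
  have sub: "X \<subseteq> topspace (full_shift A)"
    using X closedin_subset by (auto simp: subshift_def)
  have sh: "continuous_map ?Y ?Y (shift m)" for m
    using X continuous_map_shift[of A m]
    by (auto simp: continuous_map_in_subtopology subshift_def intro: continuous_map_from_subtopology)
  have os: "openin ?Y {x \<in> topspace ?Y. s x = m}" for m
    using openin_continuous_map_preimage[OF s, of "{m}"] by simp
  have ot: "openin ?Y {x \<in> topspace ?Y. t (shift (- m) x) = n}" for m n
    using openin_continuous_map_preimage[OF continuous_map_compose[OF sh t, of "- m"], of "{n}"]
    by simp
  have "openin ?Y {x \<in> topspace ?Y. s x + t (shift (- s x) x) \<in> U}" for U
  proof -
    have "{x \<in> topspace ?Y. s x + t (shift (- s x) x) \<in> U} =
      (\<Union>p \<in> {p. fst p + snd p \<in> U}.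
         {x \<in> topspace ?Y. s x = fst p} \<inter> {x \<in> topspace ?Y. t (shift (- fst p) x) = snd p})"
      by auto
    then show ?thesis
      using os ot by (auto intro!: openin_Union openin_Int)
  qed
  then show ?thesis
    by (simp add: continuous_map_def)
qed

lemma moves_head_compose:
  assumes X: "subshift A X" and S: "moves_head A X S" and T: "moves_head A X T"
  shows "moves_head A X (\<lambda>p. T (S p))"
proof -
  obtain s where s: "continuous_map (subtopology (full_shift A) X) (discrete_topology UNIV) s"
      "\<forall>x\<in>X. \<forall>i. S (x, i) = (x, i + s (shift (- i) x))"
    using S by (auto simp: moves_head_def)
  obtain t where t: "continuous_map (subtopology (full_shift A) X) (discrete_topology UNIV) t"
      "\<forall>x\<in>X. \<forall>i. T (x, i) = (x, i + t (shift (- i) x))"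
    using T by (auto simp: moves_head_def)
  show ?thesis
    unfolding moves_head_def
    using continuous_map_shift_by[OF X s(1) t(1)] s(2) t(2)
    by (intro exI[of _ "\<lambda>x. s x + t (shift (- s x) x)"]) (auto simp: algebra_simps)
qed

lemma moves_head_cong:
  assumes "moves_head A X S" and "\<And>p. p \<in> X \<times> UNIV \<Longrightarrow> S p = T p"
  shows "moves_head A X T"
proof -
  from assms(1) obtain s where
    "continuous_map (subtopology (full_shift A) X) (discrete_topology UNIV) s"
    "\<forall>x\<in>X. \<forall>i. S (x, i) = (x, i + s (shift (- i) x))"
    unfolding moves_head_def by blast
  with assms(2) show ?thesis
    unfolding moves_head_def by (intro exI[of _ s]) simp
qed

lemma subgroup_RFA:
  assumes X: "subshift A X"
  shows "subgroup (carrier (RFA A X)) (BijGroup (X \<times> UNIV))"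
proof -
  let ?S = "X \<times> (UNIV :: int set)"
  interpret B: group "BijGroup ?S" by (rule group_BijGroup)
  have invB: "inv\<^bsub>BijGroup ?S\<^esub> T = restrict (inv_into ?S T) ?S" if "T \<in> Bij ?S" for T
    using that by (rule inv_BijGroup)
  have bij: "bij_betw T ?S ?S" if "T \<in> Bij ?S" for T using that by (simp add: Bij_def)
  have id: "moves_head A X (\<lambda>p. p)"
    unfolding moves_head_def by (intro exI[of _ "\<lambda>_. 0"]) auto
  have inv2: "inv_into ?S (restrict (inv_into ?S T) ?S) p = T p"
    if T: "T \<in> Bij ?S" and p: "p \<in> ?S" for T p
  proof (rule inv_into_f_eq)
    show "inj_on (restrict (inv_into ?S T) ?S) ?S"
      using restrict_inv_into_Bij[OF T] by (simp add: Bij_def bij_betw_def)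
    show Tp: "T p \<in> ?S" using bij[OF T] p by (auto simp: bij_betw_def)
    show "restrict (inv_into ?S T) ?S (T p) = p"
      using bij[OF T] p Tp by (auto simp: bij_betw_def)
  qed
  show ?thesis
  proof
    show "carrier (RFA A X) \<subseteq> carrier (BijGroup ?S)"
      by (auto simp: RFA_def BijGroup_def)
  next
    have "inv_into ?S (\<lambda>p\<in>?S. p) p = p" if "p \<in> ?S" for p
      using that by (intro inv_into_f_eq) (auto simp: inj_on_def)
    then show "\<one>\<^bsub>BijGroup ?S\<^esub> \<in> carrier (RFA A X)"
      using moves_head_cong[OF id] by (auto simp: RFA_def BijGroup_def id_Bij)
  next
    fix S T assume "S \<in> carrier (RFA A X)" "T \<in> carrier (RFA A X)"
    then have S: "S \<in> Bij ?S" "moves_head A X S" "moves_head A X (inv_into ?S S)"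
      and T: "T \<in> Bij ?S" "moves_head A X T" "moves_head A X (inv_into ?S T)"
      by (auto simp: RFA_def)
    have "inv_into ?S T (inv_into ?S S p) = inv_into ?S (compose ?S S T) p" if p: "p \<in> ?S" for p
    proof (rule inv_into_f_eq[symmetric])
      have q: "inv_into ?S S p \<in> ?S" and r: "inv_into ?S T (inv_into ?S S p) \<in> ?S"
        using Bij_inv_into_mem S(1) T(1) p by metis+
      show "inj_on (compose ?S S T) ?S"
        using compose_Bij[OF S(1) T(1)] by (simp add: Bij_def bij_betw_def)
      show "inv_into ?S T (inv_into ?S S p) \<in> ?S" by (fact r)
      show "compose ?S S T (inv_into ?S T (inv_into ?S S p)) = p"
        using q r p bij[OF S(1)] bij[OF T(1)]
        by (simp add: compose_def bij_betw_inv_into_right)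
    qed
    then have "moves_head A X (inv_into ?S (compose ?S S T))"
      by (rule moves_head_cong[OF moves_head_compose[OF X S(3) T(3)]])
    moreover have "moves_head A X (compose ?S S T)"
      by (rule moves_head_cong[OF moves_head_compose[OF X T(2) S(2)]]) (simp add: compose_def)
    ultimately show "S \<otimes>\<^bsub>BijGroup ?S\<^esub> T \<in> carrier (RFA A X)"
      using S(1) T(1) compose_Bij by (auto simp: RFA_def BijGroup_def)
  next
    fix T assume "T \<in> carrier (RFA A X)"
    then have T: "T \<in> Bij ?S" "moves_head A X T" "moves_head A X (inv_into ?S T)"
      by (auto simp: RFA_def)
    have "moves_head A X (restrict (inv_into ?S T) ?S)"
      by (rule moves_head_cong[OF T(3)]) simp
    moreover have "moves_head A X (inv_into ?S (restrict (inv_into ?S T) ?S))"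
      by (rule moves_head_cong[OF T(2)]) (simp add: inv2[OF T(1)])
    ultimately show "inv\<^bsub>BijGroup ?S\<^esub> T \<in> carrier (RFA A X)"
      using T(1) restrict_inv_into_Bij[OF T(1)] unfolding invB[OF T(1)] by (simp add: RFA_def)
  qed
qed

lemma group_RFA:
  assumes "subshift A X"
  shows "group (RFA A X)"
  using subgroup.subgroup_is_group[OF subgroup_RFA[OF assms] group_BijGroup]
  by (simp add: RFA_def)

end

theory Submission
  imports Defs
begin

text \<open>
  On a fixed tape \<open>x\<close>, an automaton \<open>T\<close> is a permutation \<open>i \<mapsto> i + d i\<close> of \<open>\<int>\<close>, where the
  displacements \<open>d\<close> are bounded, uniformly in \<open>x\<close>, because the continuous function that produces
  them has compact domain. Such an automaton is an orbitwise shift iff \<open>d\<close> is constant for every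
  \<open>x\<close>, so the aim is to make all displacements constant by composing \<open>T\<close> with swaps.

  Let \<open>M\<close> be an upper bound of the displacements. Wherever \<open>d i = M\<close> and \<open>d (i + 1) < M\<close>, let a swap
  exchange \<open>i\<close> and \<open>i + 1\<close> before \<open>T\<close> acts. The tape patterns at which this happens form a clopen
  set \<open>C\<close>, and \<open>C\<close> is disjoint from its translate because the condition at \<open>i\<close> requires
  \<open>d (i + 1) < M\<close> while the condition at \<open>i + 1\<close> requires \<open>d (i + 1) = M\<close>. The two new
  displacements are at most \<open>M - 1\<close>: at \<open>i + 1\<close> it is \<open>M - 1\<close>, and at \<open>i\<close> it is \<open>d (i + 1) + 1\<close>,
  which cannot be \<open>M\<close> by injectivity. Hence the step, called \<open>push M\<close> below, removes
  the right end of every maximal run of positions with displacement \<open>M\<close> and creates no new ones (\<open>push_eq_maxD\<close>).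

  If all displacements lie in \<open>{b..M}\<close>, then a run longer than \<open>M - b\<close> forces the whole tape to have
  displacement \<open>M\<close> (\<open>long_run_imp_constant\<close>): no position can cross such a run relative to the
  shift by \<open>M\<close>, so both sides are rigid. Consequently \<open>M - b\<close> pushes remove the value \<open>M\<close> from every
  tape except those on which \<open>T\<close> is a translation, and pushes leave the latter alone. Lowering \<open>M\<close>
  one unit at a time down to \<open>b\<close> yields constant displacements everywhere. The sequence of pushes
  depends on the bounds only (\<open>exists_constant_fold_push\<close>), so one and the same product of swaps
  works for all tapes.

  Finally, a swap controlled by a clopen set is a product of finitely many commuting swaps
  controlled by cylinders (\<open>swap_on_generated\<close>), and each swap is an involution, so \<open>T\<close> is
  recovered from the orbitwise shift by composing with the same swaps in reverse order.
\<close>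

section \<open>Pushing large displacements to the right\<close>

text \<open>
  These are the displacements of the permutation \<open>i \<mapsto> i + d i\<close> precomposed with the exchange of
  all pairs \<open>i\<close>, \<open>i + 1\<close> such that \<open>d i = M\<close> and \<open>d (i + 1) < M\<close>.
\<close>
definition push :: "int \<Rightarrow> (int \<Rightarrow> int) \<Rightarrow> int \<Rightarrow> int" where
  "push M d i =
     (if d i = M \<and> d (i + 1) < M then d (i + 1) + 1
      else if d (i - 1) = M \<and> d i < M then M - 1
      else d i)"

lemma push_const [simp]: "push M (\<lambda>_. c) = (\<lambda>_. c)"
  by (auto simp: push_def fun_eq_iff)

lemma fold_push_const: "fold push Ms (\<lambda>_. c) = (\<lambda>_. c)"
  by (induction Ms) auto

lemma push_iterate_const: "(push M ^^ n) (\<lambda>_. c) = (\<lambda>_. c)"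
  by (induction n) auto

lemma bij_push:
  assumes "bij (\<lambda>i. i + d i)"
  shows "bij (\<lambda>i. i + push M d i)"
proof -
  \<comment> \<open>the exchange of pairs that \<^term>\<open>push M\<close> encodes\<close>
  define \<tau> where "\<tau> i = (if d i = M \<and> d (i + 1) < M then i + 1
      else if d (i - 1) = M \<and> d i < M then i - 1 else i)" for i
  have "\<tau> (\<tau> i) = i" for i
    by (auto simp: \<tau>_def)
  then have "bij \<tau>"
    by (auto intro: o_bij[of \<tau>] simp: fun_eq_iff)
  moreover have "(\<lambda>i. i + push M d i) = (\<lambda>i. i + d i) \<circ> \<tau>"
    by (auto simp: push_def \<tau>_def fun_eq_iff)
  ultimately show ?thesis
    using assms by (simp add: bij_comp)
qed

lemma push_bounds:
  assumes "\<And>i. d i \<in> {b..M}" and "b < M"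
  shows "push M d i \<in> {b..M}"
  using assms(1)[of i] assms(1)[of "i + 1"] assms(2) by (auto simp: push_def)

text \<open>
  An exchange puts the displacement \<open>d (i + 1) + 1\<close> at \<open>i\<close>. It could equal \<open>M\<close> only if \<open>i\<close> and
  \<open>i + 1\<close> had the same image \<open>i + M\<close>. So the value \<open>M\<close> survives only where nothing was exchanged,
  that is, inside a run and not at its right end.
\<close>
lemma push_eq_maxD:
  assumes inj: "inj (\<lambda>i. i + d i)" and le: "\<And>i. d i \<le> M" and eq: "push M d i = M"
  shows "d i = M" and "d (i + 1) = M"
proof -
  have "d i = M \<Longrightarrow> d (i + 1) \<noteq> M - 1"
    using injD[OF inj, of i "i + 1"] by auto
  then have "d i = M \<and> d (i + 1) = M"
    using eq le[of i] le[of "i + 1"] by (auto simp: push_def split: if_splits)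
  then show "d i = M" "d (i + 1) = M" by auto
qed

text \<open>Each push shortens every run of \<open>M\<close> by one, so a survivor of \<open>n\<close> pushes began a long run.\<close>
lemma push_iterate_eq_maxD:
  assumes "bij (\<lambda>i. i + d i)" and "\<And>i. d i \<in> {b..M}" and "b < M"
    and "(push M ^^ n) d i = M" and "j \<in> {i..i + int n}"
  shows "d j = M"
  using assms
proof (induction n arbitrary: d j)
  case 0
  then show ?case by simp
next
  case (Suc n)
  have run: "push M d k = M" if "k \<in> {i..i + int n}" for k
    using Suc.IH[OF bij_push[OF Suc.prems(1)] push_bounds[OF Suc.prems(2,3)] Suc.prems(3) _ that]
      Suc.prems(4) by (simp add: funpow_swap1)
  have le: "d k \<le> M" for k using Suc.prems(2)[of k] by simp
  note D = push_eq_maxD[OF bij_is_inj[OF Suc.prems(1)] le run]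
  show ?case
  proof (cases "j \<le> i + int n")
    case True
    then show ?thesis using Suc.prems(5) by (intro D(1)) auto
  next
    case False
    then have "j = (i + int n) + 1" using Suc.prems(5) by auto
    then show ?thesis using D(2)[of "i + int n"] by simp
  qed
qed

text \<open>
  Put \<open>g j = j + d j - M\<close>, a permutation that never moves to the right, moves to the left by at most
  \<open>M - b\<close>, and fixes every point of the run. To the right of the run, going upwards, \<open>g\<close> cannot
  move a point to the left: it cannot jump over the run, so it would land on a point that is already
  known to be fixed. To the left, going downwards, the preimage of a point is not further right, as
  everything further right is fixed.
\<close>
lemma long_run_imp_constant:
  fixes d :: "int \<Rightarrow> int"
  assumes bij: "bij (\<lambda>i. i + d i)" and bounds: "\<And>i. d i \<in> {b..M}"
    and run: "\<And>j. j \<in> {i..i + (M - b)} \<Longrightarrow> d j = M"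
  shows "d j = M"
proof -
  have inj: "j = k" if "j + d j = k + d k" for j k
    using injD[OF bij_is_inj[OF bij], of j k] that by simp
  have le: "d k \<le> M" and ge: "b \<le> d k" for k using bounds[of k] by auto
  have right: "d j = M" if "i \<le> j" for j
    using that
  proof (induction "nat (j - i)" arbitrary: j rule: less_induct)
    case less
    show ?case
    proof (cases "j \<le> i + (M - b)")
      case True
      then show ?thesis using less.prems by (intro run) auto
    next
      case False
      \<comment> \<open>\<open>?k\<close> is \<open>g j\<close>; \<open>?k \<ge> i\<close> because \<open>g\<close> cannot jump over the run\<close>
      let ?k = "j + d j - M"
      have "d j \<noteq> M \<Longrightarrow> d ?k = M"
        using False ge[of j] le[of j] by (intro less.hyps) linarith+
      then show ?thesis using inj[of j ?k] by force
    qed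
  qed
  have left: "d j = M" if "j \<le> i" for j
    using that
  proof (induction "nat (i - j)" arbitrary: j rule: less_induct)
    case less
    \<comment> \<open>\<open>p\<close> is the preimage of \<open>j\<close> under \<open>g\<close>\<close>
    obtain p where p: "p + d p = j + M"
      using bij_is_surj[OF bij] by (metis surjD)
    have "d p = M" if "p \<noteq> j"
    proof (cases "p \<le> i")
      case True
      then show ?thesis using that p le[of p] by (intro less.hyps) linarith+
    next
      case False
      then show ?thesis by (intro right) simp
    qed
    then show ?case using p by (cases "p = j") auto
  qed
  show ?thesis using left right by (cases "i \<le> j") auto
qed

text \<open>
  The pushes at the top level \<open>M\<close> either exhaust the value \<open>M\<close>, so that the range of displacements
  shrinks, or are faced with a constant sequence, which all pushes fix. As \<open>Ms\<close> does not depend on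
  \<open>d\<close>, one sequence of pushes serves all tapes at once.
\<close>
lemma exists_constant_fold_push:
  "\<exists>Ms. \<forall>d. bij (\<lambda>i. i + d i) \<longrightarrow> (\<forall>i. d i \<in> {b..b + int k}) \<longrightarrow>
      (\<exists>c. fold push Ms d = (\<lambda>_. c))"
proof (induction k)
  case 0
  have "\<exists>c. fold push [] d = (\<lambda>_. c)" if "\<forall>i. d i \<in> {b..b + int 0}" for d
    using that by (auto intro!: exI[of _ b])
  then show ?case by blast
next
  case (Suc k)
  then obtain Ms where Ms: "\<And>d. bij (\<lambda>i. i + d i) \<Longrightarrow> (\<forall>i. d i \<in> {b..b + int k}) \<Longrightarrow>
      (\<exists>c. fold push Ms d = (\<lambda>_. c))" by blast
  define M where "M = b + int (Suc k)"
  have "\<exists>c. fold push (replicate (Suc k) M @ Ms) d = (\<lambda>_. c)"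
    if bij: "bij (\<lambda>i. i + d i)" and bounds: "\<And>i. d i \<in> {b..M}" for d
  proof -
    let ?e = "(push M ^^ Suc k) d"
    have bM: "b < M" by (simp add: M_def)
    have fold: "fold push (replicate (Suc k) M @ Ms) d = fold push Ms ?e"
      by (simp add: fold_replicate del: replicate_Suc funpow.simps)
    have iter: "bij (\<lambda>i. i + (push M ^^ n) d i) \<and> (\<forall>i. (push M ^^ n) d i \<in> {b..M})" for n
      by (induction n) (use bij bounds bij_push push_bounds[OF _ bM] in auto)
    show ?thesis
    proof (cases "\<exists>i. ?e i = M")
      case True
      then obtain i where i: "?e i = M" by blast
      have "d j = M" if "j \<in> {i..i + (M - b)}" for j
        using push_iterate_eq_maxD[OF bij bounds bM i] that by (simp add: M_def)
      then have "d = (\<lambda>_. M)"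
        using long_run_imp_constant[OF bij bounds] by blast
      then show ?thesis using fold by (simp only: push_iterate_const fold_push_const) blast
    next
      case False
      have "y \<in> {b..M} \<Longrightarrow> y \<noteq> M \<Longrightarrow> y \<in> {b..b + int k}" for y
        by (auto simp: M_def)
      then have "\<forall>i. ?e i \<in> {b..b + int k}"
        using iter[of "Suc k"] False by metis
      then show ?thesis using Ms iter fold by metis
    qed
  qed
  then show ?case unfolding M_def by blast
qed

section \<open>Continuity and finite windows\<close>

definition agree :: "nat \<Rightarrow> (int \<Rightarrow> 'a) \<Rightarrow> (int \<Rightarrow> 'a) \<Rightarrow> bool" where
  "agree n x y \<longleftrightarrow> (\<forall>j\<in>{- int n..int n}. x j = y j)"

lemma agree_refl [simp]: "agree n x x"
  by (simp add: agree_def)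

lemma agree_trans: "agree n x y \<Longrightarrow> agree n y z \<Longrightarrow> agree n x z"
  by (simp add: agree_def)

lemma agree_sym: "agree n x y \<Longrightarrow> agree n y x"
  by (simp add: agree_def)

lemma agree_mono: "agree n x y \<Longrightarrow> m \<le> n \<Longrightarrow> agree m x y"
  by (auto simp: agree_def)

lemma agree_shift: "agree (n + nat \<bar>m\<bar>) x y \<Longrightarrow> agree n (shift m x) (shift m y)"
  unfolding agree_def shift_def by (intro ballI, drule_tac x = "j - m" in bspec) auto

definition window :: "(int \<Rightarrow> 'a) set \<Rightarrow> nat \<Rightarrow> (int \<Rightarrow> 'a) \<Rightarrow> (int \<Rightarrow> 'a) set" where
  "window X n x = {y \<in> X. agree n x y}"

lemma subshift_in_alphabet: "subshift A X \<Longrightarrow> x \<in> X \<Longrightarrow> x i \<in> A"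
  using closedin_subset[of "full_shift A" X]
  by (auto simp: subshift_def full_shift_def PiE_iff)

lemma shift_in_subshift: "subshift A X \<Longrightarrow> x \<in> X \<Longrightarrow> shift m x \<in> X"
  by (simp add: subshift_def)

lemma topspace_subshift: "subshift A X \<Longrightarrow> topspace (subtopology (full_shift A) X) = X"
  using closedin_subset[of "full_shift A" X] by (auto simp: subshift_def)

lemma openin_window:
  assumes "subshift A X"
  shows "openin (subtopology (full_shift A) X) (window X n x)"
proof -
  have "continuous_map (full_shift A) (discrete_topology A) (\<lambda>y. y j)" for j
    unfolding full_shift_def by (rule continuous_map_product_projection) simp
  then have "openin (full_shift A) {y \<in> topspace (full_shift A). y j \<in> {x j} \<inter> A}" for j
    by (rule openin_continuous_map_preimage) simp
  then have "openin (full_shift A)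
      (\<Inter>j\<in>{- int n..int n}. {y \<in> topspace (full_shift A). y j \<in> {x j} \<inter> A})"
    by (intro openin_INT2) auto
  then show ?thesis
    unfolding openin_subtopology
  proof (intro exI conjI)
    show "window X n x =
      (\<Inter>j\<in>{- int n..int n}. {y \<in> topspace (full_shift A). y j \<in> {x j} \<inter> A}) \<inter> X"
      using subshift_in_alphabet[OF assms] topspace_subshift[OF assms]
      by (auto simp: window_def agree_def)
  qed
qed

lemma window_basis:
  assumes U: "openin (subtopology (full_shift A) X) U" and x: "x \<in> U" and X: "subshift A X"
  shows "\<exists>n. window X n x \<subseteq> U"
proof -
  obtain V where V: "openin (full_shift A) V" "U = V \<inter> X"
    using U by (auto simp: openin_subtopology)
  then obtain B where B: "finite {i. B i \<noteq> A}" "x \<in> Pi\<^sub>E UNIV B" "Pi\<^sub>E UNIV B \<subseteq> V"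
    using x unfolding full_shift_def openin_product_topology_alt by fastforce
  define n where "n = Max (insert 0 ((\<lambda>i. nat \<bar>i\<bar>) ` {i. B i \<noteq> A}))"
  have n: "i \<in> {- int n..int n}" if "B i \<noteq> A" for i
  proof -
    have "nat \<bar>i\<bar> \<le> n" unfolding n_def using B(1) that by (intro Max_ge) auto
    then show ?thesis by auto
  qed
  have "y \<in> U" if y: "y \<in> window X n x" for y
  proof -
    have "y i \<in> B i" for i
    proof (cases "B i = A")
      case True
      then show ?thesis using y subshift_in_alphabet[OF X] by (auto simp: window_def)
    next
      case False
      then have "y i = x i" using n[of i] y by (auto simp: window_def agree_def)
      then show ?thesis using B(2) by (auto simp: PiE_iff)
    qed
    then show ?thesis using V(2) B(3) y by (auto simp: PiE_iff window_def)
  qed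
  then show ?thesis by blast
qed

lemma compact_subshift:
  assumes "finite A" and "subshift A X"
  shows "compactin (subtopology (full_shift A) X) X"
proof -
  have "compact_space (full_shift A)"
    unfolding full_shift_def using assms(1)
    by (simp add: compact_space_product_topology compact_space_discrete_topology)
  then show ?thesis
    using assms(2) closedin_compact_space[of "full_shift A" X]
    by (simp add: compactin_subtopology subshift_def)
qed

text \<open>
  A continuous function into a discrete space is locally constant, so around each point it is
  determined by some window; by compactness one window size works everywhere.
\<close>
lemma continuous_iff_window:
  assumes A: "finite A" and X: "subshift A X"
  shows "continuous_map (subtopology (full_shift A) X) (discrete_topology UNIV) s \<longleftrightarrow>
    (\<exists>n. \<forall>x\<in>X. \<forall>y\<in>X. agree n x y \<longrightarrow> s x = s y)"
    (is "?L \<longleftrightarrow> ?R")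
proof
  let ?Y = "subtopology (full_shift A) X"
  assume L: ?L
  \<comment> \<open>the points around which a window of radius \<open>n\<close> suffices; these sets are open and increasing\<close>
  define V where "V n = {x \<in> X. window X n x \<subseteq> {y. s y = s x}}" for n
  have win: "window X n x \<subseteq> V n" if "x \<in> V n" for n x
  proof
    fix y assume y: "y \<in> window X n x"
    have "window X n y \<subseteq> window X n x"
      using y agree_trans[of n x y] by (auto simp: window_def)
    moreover have V: "window X n x \<subseteq> {z. s z = s x}" using that by (simp add: V_def)
    ultimately have "window X n y \<subseteq> {z. s z = s x}" by (rule subset_trans)
    moreover have "s y = s x" using V y by blast
    moreover have "y \<in> X" using y by (simp add: window_def)
    ultimately show "y \<in> V n" by (simp add: V_def)
  qed
  have "openin ?Y (V n)" for n
  proof (subst openin_subopen, intro ballI exI conjI)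
    fix x assume x: "x \<in> V n"
    show "openin ?Y (window X n x)" by (rule openin_window[OF X])
    show "x \<in> window X n x" using x by (simp add: V_def window_def)
    show "window X n x \<subseteq> V n" using x by (rule win)
  qed
  moreover have "X \<subseteq> \<Union> (range V)"
  proof
    fix x assume x: "x \<in> X"
    have "openin ?Y {y \<in> X. s y = s x}"
      using openin_continuous_map_preimage[OF L, of "{s x}"] unfolding topspace_subshift[OF X] by simp
    then obtain n where "window X n x \<subseteq> {y \<in> X. s y = s x}"
      using window_basis[OF _ _ X] x by blast
    then have "x \<in> V n" using x unfolding V_def by blast
    then show "x \<in> \<Union> (range V)" by blast
  qed
  ultimately obtain N where N: "finite N" "X \<subseteq> \<Union> (V ` N)"
    using compactinD[OF compact_subshift[OF A X], of "range V"]
    by (metis (no_types, lifting) finite_subset_image imageE)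
  show ?R
  proof (intro exI ballI impI)
    fix x y assume x: "x \<in> X" and y: "y \<in> X" and xy: "agree (Max N) x y"
    obtain n where n: "n \<in> N" "x \<in> V n" using N x by blast
    have "y \<in> window X n x"
      using agree_mono[OF xy] N(1) n(1) y by (simp add: window_def)
    then have "s y = s x" using n(2) unfolding V_def by blast
    then show "s x = s y" by (rule sym)
  qed
next
  assume ?R
  then obtain n where n: "\<And>x y. x \<in> X \<Longrightarrow> y \<in> X \<Longrightarrow> agree n x y \<Longrightarrow> s x = s y" by blast
  have "openin (subtopology (full_shift A) X) {x \<in> X. s x \<in> U}" for U
  proof (subst openin_subopen, intro ballI exI conjI)
    fix x assume x: "x \<in> {x \<in> X. s x \<in> U}"
    show "openin (subtopology (full_shift A) X) (window X n x)" by (rule openin_window[OF X])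
    show "x \<in> window X n x" using x by (simp add: window_def)
    show "window X n x \<subseteq> {x \<in> X. s x \<in> U}" 
    proof
      fix y assume "y \<in> window X n x"
      then show "y \<in> {x \<in> X. s x \<in> U}" using x n[of x y] by (simp add: window_def)
    qed
  qed
  then show ?L unfolding continuous_map_def topspace_subshift[OF X] by simp
qed

text \<open>A window is determined by a word of length \<open>2 * n + 1\<close> over the finite alphabet.\<close>
lemma finite_windows:
  assumes "finite A" and "subshift A X"
  shows "finite (window X n ` X)"
proof -
  let ?J = "{- int n..int n}"
  define w where "w r = {y \<in> X. \<forall>j\<in>?J. r j = y j}" for r
  have "window X n x \<in> w ` (?J \<rightarrow>\<^sub>E A)" if "x \<in> X" for x
  proof
    show "window X n x = w (restrict x ?J)"
      by (auto simp: window_def agree_def w_def)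
    show "restrict x ?J \<in> ?J \<rightarrow>\<^sub>E A"
      using subshift_in_alphabet[OF assms(2) that] by auto
  qed
  then have "window X n ` X \<subseteq> w ` (?J \<rightarrow>\<^sub>E A)" by blast
  moreover have "finite (?J \<rightarrow>\<^sub>E A)" using assms(1) by (intro finite_PiE) auto
  ultimately show ?thesis by (meson finite_imageI finite_subset)
qed

lemma context_cylinder_eq_window:
  assumes "x \<in> X"
  shows "context_cylinder X (map x [- int n..-1]) (x 0) (map x [1..int n]) = window X n x"
proof -
  have "{- int n..int n} = {- int n..-1} \<union> {0} \<union> {1..int n}" by auto
  then show ?thesis
    by (auto simp: context_cylinder_def window_def agree_def)
qed

lemma window_disjoint:
  "window X n x \<noteq> window X n y \<Longrightarrow> window X n x \<inter> window X n y = {}"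
  unfolding window_def agree_def by fastforce

section \<open>Swaps controlled by clopen sets\<close>

definition swap_on :: "(int \<Rightarrow> 'a) set \<Rightarrow> (int \<Rightarrow> 'a) set \<Rightarrow> 'a head_conf \<Rightarrow> 'a head_conf" where
  "swap_on X C =
     (\<lambda>(x, i) \<in> X \<times> UNIV.
        if shift (- i) x \<in> C then (x, i + 1)
        else if shift (- i + 1) x \<in> C then (x, i - 1)
        else (x, i))"

lemma position_swap_eq_swap_on: "position_swap X u a v = swap_on X (context_cylinder X u a v)"
  by (simp add: position_swap_def swap_on_def)

text \<open>
  The condition \<open>C \<inter> shift 1 ` C = {}\<close> means that a pair of positions to be exchanged never shares
  a position with the next such pair.
\<close>
lemma shift_disjointD:
  assumes "C \<inter> shift 1 ` C = {}" and "shift m x \<in> C" and "n = m + 1"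
  shows "shift n x \<notin> C"
  using assms by (metis IntI add.commute empty_iff imageI shift_shift)

lemma swap_on_involution:
  assumes "C \<inter> shift 1 ` C = {}" and "p \<in> X \<times> UNIV"
  shows "swap_on X C (swap_on X C p) = p"
proof -
  obtain x i where p: "p = (x, i)" by force
  show ?thesis
    using assms(2) shift_disjointD[OF assms(1), of "- i" x "- i + 1"]
      shift_disjointD[OF assms(1), of "- i - 1" x "- i"]
    by (auto simp: p swap_on_def)
qed

lemma swap_on_Un:
  assumes "(C \<union> D) \<inter> shift 1 ` (C \<union> D) = {}" and "C \<inter> D = {}"
  shows "swap_on X (C \<union> D) = compose (X \<times> UNIV) (swap_on X C) (swap_on X D)"
proof
  fix p :: "'a head_conf"
  obtain x i where p: "p = (x, i)" by force
  have S: "shift n x \<notin> C \<union> D" if "shift m x \<in> C \<union> D" "n = m + 1" for m n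
    using shift_disjointD[OF assms(1) that] .
  show "swap_on X (C \<union> D) p = compose (X \<times> UNIV) (swap_on X C) (swap_on X D) p"
    using S[of "- i" "- i + 1"] S[of "- i - 1" "- i"] S[of "- i + 1" "- i + 2"] assms(2)
    by (auto simp: p swap_on_def compose_def)
qed

lemma swap_on_in_RFA:
  assumes A: "finite A" and X: "subshift A X" and disj: "C \<inter> shift 1 ` C = {}"
    and C: "\<And>x y. x \<in> X \<Longrightarrow> y \<in> X \<Longrightarrow> agree n x y \<Longrightarrow> x \<in> C \<longleftrightarrow> y \<in> C"
  shows "swap_on X C \<in> carrier (RFA A X)"
proof -
  let ?S = "X \<times> (UNIV :: int set)" and ?T = "swap_on X C"
  have mem: "?T p \<in> ?S" if "p \<in> ?S" for p
    using that by (auto simp: swap_on_def)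
  have "?T ` ?S \<subseteq> ?S" using mem by (rule image_subsetI)
  then have bij: "bij_betw ?T ?S ?S"
    using swap_on_involution[OF disj] by (intro bij_betw_byWitness[where f' = ?T]) blast+
  define s :: "(int \<Rightarrow> 'a) \<Rightarrow> int"
    where "s x = (if x \<in> C then 1 else if shift 1 x \<in> C then -1 else 0)" for x
  have "s x = s y" if "x \<in> X" "y \<in> X" "agree (n + 1) x y" for x y
  proof -
    have "x \<in> C \<longleftrightarrow> y \<in> C"
      using that by (intro C agree_mono[OF that(3)]) auto
    moreover have "shift 1 x \<in> C \<longleftrightarrow> shift 1 y \<in> C"
      using that agree_shift[of n 1 x y] by (intro C shift_in_subshift[OF X]) auto
    ultimately show ?thesis by (simp add: s_def)
  qed
  then have "continuous_map (subtopology (full_shift A) X) (discrete_topology UNIV) s"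
    unfolding continuous_iff_window[OF A X] by blast
  moreover have "\<forall>x\<in>X. \<forall>i. ?T (x, i) = (x, i + s (shift (- i) x))"
    by (auto simp: swap_on_def s_def)
  ultimately have mv: "moves_head A X ?T"
    unfolding moves_head_def by blast
  moreover have "?T p = inv_into ?S ?T p" if "p \<in> ?S" for p
    using that bij mem swap_on_involution[OF disj] inv_into_f_eq[of ?T ?S "?T p" p]
    by (simp add: bij_betw_def)
  then have "moves_head A X (inv_into ?S ?T)"
    by (rule moves_head_cong[OF mv])
  moreover have "?T \<in> Bij ?S"
    using bij by (simp add: Bij_def swap_on_def)
  ultimately show ?thesis
    by (simp add: RFA_def)
qed

lemma RFA_mult:
  assumes "S \<in> carrier (RFA A X)" and "T \<in> carrier (RFA A X)"
  shows "S \<otimes>\<^bsub>RFA A X\<^esub> T = compose (X \<times> UNIV) S T"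
  using assms by (simp add: RFA_def BijGroup_def)

lemma window_swap_in_controlled_position_swaps:
  assumes X: "subshift A X" and x: "x \<in> X"
    and disj: "window X n x \<inter> shift 1 ` window X n x = {}"
  shows "swap_on X (window X n x) \<in> controlled_position_swaps A X"
proof -
  note eq = context_cylinder_eq_window[OF x, of n]
  show ?thesis
    unfolding controlled_position_swaps_def mem_Collect_eq
    using subshift_in_alphabet[OF X x] disj
    by (intro exI[of _ "map x [- int n..-1]"] exI[of _ "x 0"] exI[of _ "map x [1..int n]"])
      (auto simp: position_swap_eq_swap_on eq)
qed

lemma controlled_position_swaps_subset_RFA:
  assumes A: "finite A" and X: "subshift A X"
  shows "controlled_position_swaps A X \<subseteq> carrier (RFA A X)"
proof
  fix T assume "T \<in> controlled_position_swaps A X"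
  then obtain u a v where T: "T = swap_on X (context_cylinder X u a v)"
    and disj: "context_cylinder X u a v \<inter> shift 1 ` context_cylinder X u a v = {}"
    by (auto simp: controlled_position_swaps_def position_swap_eq_swap_on)
  let ?n = "length u + length v"
  have "x \<in> context_cylinder X u a v \<longleftrightarrow> y \<in> context_cylinder X u a v"
    if "x \<in> X" "y \<in> X" "agree ?n x y" for x y
  proof -
    have "map x [- int (length u)..-1] = map y [- int (length u)..-1]"
      "x 0 = y 0" "map x [1..int (length v)] = map y [1..int (length v)]"
      using that(3) by (auto simp: agree_def)
    then show ?thesis
      using that(1,2) by (simp only: context_cylinder_def mem_Collect_eq simp_thms)
  qed
  then show "T \<in> carrier (RFA A X)"
    unfolding T by (rule swap_on_in_RFA[OF A X disj])
qed

text \<open>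
  \<open>C\<close> is the disjoint union of finitely many windows. Each of them inherits the disjointness
  condition from \<open>C\<close>, hence controls a well-defined swap, and by \<open>swap_on_Un\<close> the composition of
  these swaps is the swap controlled by \<open>C\<close>.
\<close>
lemma swap_on_generated:
  assumes A: "finite A" and X: "subshift A X" and "C \<subseteq> X" and disj: "C \<inter> shift 1 ` C = {}"
    and C: "\<And>x y. x \<in> X \<Longrightarrow> y \<in> X \<Longrightarrow> agree n x y \<Longrightarrow> x \<in> C \<longleftrightarrow> y \<in> C"
  shows "swap_on X C \<in> generate (RFA A X) (controlled_position_swaps A X)"
proof -
  let ?G = "generate (RFA A X) (controlled_position_swaps A X)"
  interpret R: group "RFA A X" by (rule group_RFA[OF X])
  have GR: "?G \<subseteq> carrier (RFA A X)"
    using R.generate_incl controlled_position_swaps_subset_RFA[OF A X] by blast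
  have sub: "window X n x \<subseteq> C" if "x \<in> C" for x
    using that C[of x] \<open>C \<subseteq> X\<close> by (auto simp: window_def)
  have fin: "finite (window X n ` C)"
    using finite_windows[OF A X] \<open>C \<subseteq> X\<close> by (meson finite_subset image_mono)
  have "swap_on X (\<Union>F) \<in> ?G" if "finite F" "F \<subseteq> window X n ` C" for F
    using that
  proof (induction F rule: finite_induct)
    case empty
    have "swap_on X {} = \<one>\<^bsub>RFA A X\<^esub>"
      by (auto simp: swap_on_def RFA_def BijGroup_def fun_eq_iff)
    then show ?case by (simp add: generate.one)
  next
    case (insert W F)
    then obtain x where x: "x \<in> C" "W = window X n x" by blast
    have WF: "W \<union> \<Union>F \<subseteq> C" using insert.prems sub by blast
    then have shd: "(W \<union> \<Union>F) \<inter> shift 1 ` (W \<union> \<Union>F) = {}" using disj by blast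
    have "W \<inter> V = {}" if "V \<in> F" for V
    proof -
      obtain y where "V = window X n y" using insert.prems \<open>V \<in> F\<close> by blast
      moreover have "W \<noteq> V" using insert.hyps \<open>V \<in> F\<close> by blast
      ultimately show ?thesis using window_disjoint x(2) by metis
    qed
    then have "W \<inter> \<Union>F = {}" by blast
    then have eq: "swap_on X (\<Union>(insert W F)) =
        compose (X \<times> UNIV) (swap_on X W) (swap_on X (\<Union>F))"
      using swap_on_Un[OF shd] by simp
    have F: "swap_on X (\<Union>F) \<in> ?G" using insert by simp
    have "swap_on X W \<in> controlled_position_swaps A X"
      unfolding x(2) using shd x \<open>C \<subseteq> X\<close>
      by (intro window_swap_in_controlled_position_swaps[OF X]) auto
    then have W: "swap_on X W \<in> ?G" by (rule generate.incl)
    show ?case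
      using generate.eng[OF W F] RFA_mult[OF subsetD[OF GR W] subsetD[OF GR F]] unfolding eq by simp
  qed
  from this[OF fin subset_refl] have "swap_on X (\<Union>(window X n ` C)) \<in> ?G" .
  moreover have "x \<in> window X n x" if "x \<in> C" for x
    using that \<open>C \<subseteq> X\<close> by (auto simp: window_def)
  then have "\<Union>(window X n ` C) = C" using sub by blast
  ultimately show ?thesis by simp
qed

section \<open>Displacements of reversible automata\<close>

definition disp :: "('a head_conf \<Rightarrow> 'a head_conf) \<Rightarrow> (int \<Rightarrow> 'a) \<Rightarrow> int \<Rightarrow> int" where
  "disp T x i = snd (T (x, i)) - i"

lemma RFA_disp:
  assumes T: "T \<in> carrier (RFA A X)"
  obtains s where "continuous_map (subtopology (full_shift A) X) (discrete_topology UNIV) s"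
    and "\<And>x i. x \<in> X \<Longrightarrow> T (x, i) = (x, i + disp T x i)"
    and "\<And>x i. x \<in> X \<Longrightarrow> disp T x i = s (shift (- i) x)"
  using T by (auto simp: RFA_def moves_head_def disp_def)

lemma bij_disp:
  assumes T: "T \<in> carrier (RFA A X)" and x: "x \<in> X"
  shows "bij (\<lambda>i. i + disp T x i)"
proof -
  have eq: "\<And>x i. x \<in> X \<Longrightarrow> T (x, i) = (x, i + disp T x i)"
    using RFA_disp[OF T] by metis
  have bij: "bij_betw T (X \<times> UNIV) (X \<times> UNIV)"
    using T by (simp add: RFA_def Bij_def)
  show ?thesis
  proof (rule bijI)
    show "inj (\<lambda>i. i + disp T x i)"
    proof (rule injI)
      fix i j assume "i + disp T x i = j + disp T x j"
      then have "T (x, i) = T (x, j)" using eq[OF x] by simp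
      then show "i = j" using bij_betw_imp_inj_on[OF bij] x by (auto dest: inj_onD)
    qed
    have "\<exists>i. j = i + disp T x i" for j
    proof -
      have "(x, j) \<in> T ` (X \<times> UNIV)" using bij x by (auto simp: bij_betw_def)
      then obtain z i where "z \<in> X" "(x, j) = T (z, i)" by blast
      then show ?thesis using eq[of z i] by auto
    qed
    then show "surj (\<lambda>i. i + disp T x i)" by (simp add: surj_def)
  qed
qed

lemma disp_bounded:
  assumes A: "finite A" and X: "subshift A X" and T: "T \<in> carrier (RFA A X)"
  obtains b k where "\<And>x i. x \<in> X \<Longrightarrow> disp T x i \<in> {b..b + int k}"
proof -
  obtain s where s: "continuous_map (subtopology (full_shift A) X) (discrete_topology UNIV) s"
    and d: "\<And>x i. x \<in> X \<Longrightarrow> disp T x i = s (shift (- i) x)"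
    using RFA_disp[OF T] by metis
  have "finite (s ` X)"
    using image_compactin[OF compact_subshift[OF A X] s] by (simp add: compactin_discrete_topology)
  then obtain b c where "\<And>y. y \<in> s ` X \<Longrightarrow> b \<le> y" "\<And>y. y \<in> s ` X \<Longrightarrow> y \<le> c"
    by (meson Max_ge Min_le)
  then have "disp T x i \<in> {b..b + int (nat (c - b))}" if "x \<in> X" for x i
    using d[OF that] shift_in_subshift[OF X that, of "- i"] by force
  then show ?thesis by (rule that)
qed

text \<open>
  The link between automata and sequences: one and the same swap performs the push of level \<open>M\<close> on
  all tapes simultaneously, because the condition for an exchange at \<open>i\<close> is a clopen condition on
  the tape seen from \<open>i\<close>.
\<close>
lemma ex_swap_pushing_disp:
  assumes A: "finite A" and X: "subshift A X" and T: "T \<in> carrier (RFA A X)"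
  obtains S where "S \<in> generate (RFA A X) (controlled_position_swaps A X)"
    and "compose (X \<times> UNIV) S S = \<one>\<^bsub>RFA A X\<^esub>"
    and "\<And>x. x \<in> X \<Longrightarrow> disp (compose (X \<times> UNIV) T S) x = push M (disp T x)"
proof -
  obtain s where s: "continuous_map (subtopology (full_shift A) X) (discrete_topology UNIV) s"
    and eq: "\<And>x i. x \<in> X \<Longrightarrow> T (x, i) = (x, i + disp T x i)"
    and d: "\<And>x i. x \<in> X \<Longrightarrow> disp T x i = s (shift (- i) x)"
    using RFA_disp[OF T] by metis
  obtain n where n: "\<And>x y. x \<in> X \<Longrightarrow> y \<in> X \<Longrightarrow> agree n x y \<Longrightarrow> s x = s y"
    using s unfolding continuous_iff_window[OF A X] by blast
  define C where "C = {x \<in> X. s x = M \<and> s (shift (- 1) x) < M}"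
  have mem: "shift (- i) x \<in> C \<longleftrightarrow> disp T x i = M \<and> disp T x (i + 1) < M" if "x \<in> X" for x i
  proof -
    have "shift (- 1) (shift (- i) x) = shift (- (i + 1)) x"
      by (simp add: shift_def algebra_simps)
    then show ?thesis
      using that shift_in_subshift[OF X that] unfolding C_def by (simp add: d del: shift_shift)
  qed
  have disj: "C \<inter> shift 1 ` C = {}"
    by (auto simp: C_def)
  have win: "x \<in> C \<longleftrightarrow> y \<in> C" if "x \<in> X" "y \<in> X" "agree (n + 1) x y" for x y
  proof -
    have "s x = s y"
      using that by (intro n agree_mono[OF that(3)]) auto
    moreover have "s (shift (- 1) x) = s (shift (- 1) y)"
      using that agree_shift[of n "- 1" x y] by (intro n shift_in_subshift[OF X]) auto
    ultimately show ?thesis using that by (simp add: C_def)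
  qed
  show ?thesis
  proof
    show "swap_on X C \<in> generate (RFA A X) (controlled_position_swaps A X)"
      by (rule swap_on_generated[OF A X _ disj win]) (auto simp: C_def)
    show "compose (X \<times> UNIV) (swap_on X C) (swap_on X C) = \<one>\<^bsub>RFA A X\<^esub>"
      using swap_on_involution[OF disj, of _ X]
      by (auto simp: compose_def RFA_def BijGroup_def fun_eq_iff)
    fix x assume x: "x \<in> X"
    have "compose (X \<times> UNIV) T (swap_on X C) (x, i) = (x, i + push M (disp T x) i)" for i
    proof -
      have "swap_on X C (x, i) =
         (if disp T x i = M \<and> disp T x (i + 1) < M then (x, i + 1)
          else if disp T x (i - 1) = M \<and> disp T x i < M then (x, i - 1)
          else (x, i))"
        using mem[OF x, of i] mem[OF x, of "i - 1"] x by (simp add: swap_on_def)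
      then show ?thesis
        using x eq[OF x] by (simp add: compose_def push_def)
    qed
    then show "disp (compose (X \<times> UNIV) T (swap_on X C)) x = push M (disp T x)"
      by (simp add: disp_def[of "compose _ _ _"] fun_eq_iff)
  qed
qed

text \<open>
  Pushing turns \<open>T\<close> into \<open>T \<circ> S\<close>, and \<open>S\<close> is an involution in the generated group, so \<open>T\<close>
  belongs to that group as soon as \<open>T \<circ> S\<close> does.
\<close>
lemma RFA_generated_if_fold_push_constant:
  assumes A: "finite A" and X: "subshift A X" and T: "T \<in> carrier (RFA A X)"
    and const: "\<And>x. x \<in> X \<Longrightarrow> \<exists>c. fold push Ms (disp T x) = (\<lambda>_. c)"
  shows "T \<in> generate (RFA A X) (orbitwise_shifts A X \<union> controlled_position_swaps A X)"
    (is "_ \<in> ?G")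
  using T const
proof (induction Ms arbitrary: T)
  case Nil
  have "\<exists>m. \<forall>i. T (x, i) = (x, i - m)" if x: "x \<in> X" for x
  proof -
    obtain c where "disp T x = (\<lambda>_. c)" using Nil.prems(2)[OF x] by auto
    moreover have "T (x, i) = (x, i + disp T x i)" for i
      using RFA_disp[OF Nil.prems(1)] x by metis
    ultimately show ?thesis by (intro exI[of _ "- c"]) simp
  qed
  then show ?case
    using Nil.prems(1) by (auto simp: orbitwise_shifts_def intro: generate.incl)
next
  case (Cons M Ms)
  interpret R: group "RFA A X" by (rule group_RFA[OF X])
  obtain S where S: "S \<in> generate (RFA A X) (controlled_position_swaps A X)"
    and SS: "compose (X \<times> UNIV) S S = \<one>\<^bsub>RFA A X\<^esub>"
    and dS: "\<And>x. x \<in> X \<Longrightarrow> disp (compose (X \<times> UNIV) T S) x = push M (disp T x)"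
    using ex_swap_pushing_disp[OF A X Cons.prems(1)] by metis
  have SR: "S \<in> carrier (RFA A X)"
    using S R.generate_in_carrier[OF controlled_position_swaps_subset_RFA[OF A X]] by blast
  have SG: "S \<in> ?G"
    using S R.mono_generate[of "controlled_position_swaps A X"] by blast
  let ?T = "T \<otimes>\<^bsub>RFA A X\<^esub> S"
  have "?T \<in> ?G"
  proof (rule Cons.IH)
    show "?T \<in> carrier (RFA A X)" using Cons.prems(1) SR by simp
    show "\<exists>c. fold push Ms (disp ?T x) = (\<lambda>_. c)" if "x \<in> X" for x
      using Cons.prems(2)[OF that] dS[OF that] RFA_mult[OF Cons.prems(1) SR] by simp
  qed
  then have "?T \<otimes>\<^bsub>RFA A X\<^esub> S \<in> ?G" using SG by (rule generate.eng)
  moreover have "?T \<otimes>\<^bsub>RFA A X\<^esub> S = T"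
    using SS Cons.prems(1) SR RFA_mult[OF SR SR] by (simp add: R.m_assoc)
  ultimately show ?case by simp
qed

theorem theorem3p28:
  fixes A :: "'a set" and X :: "(int \<Rightarrow> 'a) set"
  assumes "finite A" and "subshift A X"
  shows "generate (RFA A X) (orbitwise_shifts A X \<union> controlled_position_swaps A X)
           = carrier (RFA A X)"
proof
  interpret R: group "RFA A X" by (rule group_RFA[OF assms(2)])
  show "generate (RFA A X) (orbitwise_shifts A X \<union> controlled_position_swaps A X)
      \<subseteq> carrier (RFA A X)"
    using controlled_position_swaps_subset_RFA[OF assms]
    by (intro R.generate_incl) (auto simp: orbitwise_shifts_def)
  show "carrier (RFA A X)
      \<subseteq> generate (RFA A X) (orbitwise_shifts A X \<union> controlled_position_swaps A X)"
  proof
    fix T assume T: "T \<in> carrier (RFA A X)"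
    obtain b k where bounds: "\<And>x i. x \<in> X \<Longrightarrow> disp T x i \<in> {b..b + int k}"
      using disp_bounded[OF assms T] by metis
    obtain Ms where "\<And>d. bij (\<lambda>i. i + d i) \<Longrightarrow> (\<forall>i. d i \<in> {b..b + int k}) \<Longrightarrow>
        \<exists>c. fold push Ms d = (\<lambda>_. c)"
      using exists_constant_fold_push by blast
    then show "T \<in> generate (RFA A X) (orbitwise_shifts A X \<union> controlled_position_swaps A X)"
      using bij_disp[OF T] bounds
      by (intro RFA_generated_if_fold_push_constant[OF assms T]) blast
  qed
qed

end
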